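(* Let $r\in\mathbb{N}\cup\{\infty\}$. Every connected graph $G$ has a graph-decomposition of adhesion one and locality $r$ such that each of its bags is $r$-locally 2-connected or a single edge.
   Context: For a vertex $v$ and integer $s$, $B_s(v)$ is the subgraph induced by vertices at distance at most $s$ from $v$ with edges joining two vertices at distance exactly $s$ removed; for a half-integer $s+\tfrac12$, $B_{s+1/2}(v)$ is induced by vertices at distance at most $s$. A vertex $v$ is an $r$-local cutvertex if $B_{r/2}(v)-v$ is disconnected. A connected graph is $r$-locally 2-connected if it has no $r$-local cutvertex and contains a cycle of length at most $r$. Graph-decomposition: a bipartite graph with bipartition $(B,S)$ (elements of $B$ are bags, of $S$ local separators), a graph $G_x$ for each node $x$, and for each edge $e$ from $s\in S$ to $b\in B$ an embedding $\iota_e$ of $G_s$ onto a subgraph of $G_b$. The underlying graph is obtained from the disjoint union of the $G_b$, $b\in B$, by identifying, for each $s\in S$, all copies $\iota_e(G_s)$ ($e$ incident with $s$) along their isomorphisms with $G_s$ (keeping only one copy of the edges corresponding to each edge of $G_s$); it is a graph-decomposition of $G$ if the underlying graph is $G$. A bag means the graph $G_b$. Adhesion is $\max_{s\in S}|V(G_s)|$. With images of the $\iota_f$ for fixed $s$ disjoint, label each edge of $G$ between a vertex of $s$ and a vertex outside $s$ by the unique $f$ whose $\iota_f$ maps a vertex of $G_s$ to an endvertex of it; a traversal of $s$ by a cycle $o$ is a maximal nonempty subpath of $o$ inside $s$ whose preceding and succeeding edges on $o$ have different labels; $o$ traverses $s$ oddly if the number of traversals is odd. Locality $r$: every cycle traversing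 some local separator oddly has length larger than $r$.
   Formalization: The one-vertex graph is excluded: it is connected, but every permitted bag contains an edge and so gives an edge of the underlying graph, while with no bags the underlying graph is empty, so it has no such graph-decomposition. *)

theory Defs
  imports Main "HOL-Library.Extended_Nat"
begin

section \<open>Simple graphs\<close>

text \<open>Undirected graphs without loops and parallel edges; not necessarily finite.\<close>

record 'a ugraph =
  verts :: "'a set"
  edges :: "'a set set"

definition wf_graph :: "'a ugraph \<Rightarrow> bool" where
  "wf_graph G \<longleftrightarrow> (\<forall>e\<in>edges G. e \<subseteq> verts G \<and> card e = 2)"

definition walk :: "'a ugraph \<Rightarrow> 'a list \<Rightarrow> 'a \<Rightarrow> 'a \<Rightarrow> bool" where
  "walk G p u v \<longleftrightarrow>
     p \<noteq> [] \<and> hd p = u \<and> last p = v \<and> set p \<subseteq> verts G \<and>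
     successively (\<lambda>x y. {x, y} \<in> edges G) p"

text \<open>The graph without vertices is neither connected nor disconnected.\<close>

definition disconnected_graph :: "'a ugraph \<Rightarrow> bool" where
  "disconnected_graph G \<longleftrightarrow> (\<exists>u\<in>verts G. \<exists>v\<in>verts G. \<nexists>p. walk G p u v)"

definition connected_graph :: "'a ugraph \<Rightarrow> bool" where
  "connected_graph G \<longleftrightarrow> verts G \<noteq> {} \<and> \<not> disconnected_graph G"

definition gdist :: "'a ugraph \<Rightarrow> 'a \<Rightarrow> 'a \<Rightarrow> enat" where
  "gdist G u v = (INF p\<in>{p. walk G p u v}. enat (length p - 1))"

definition induced :: "'a ugraph \<Rightarrow> 'a set \<Rightarrow> 'a ugraph" where
  "induced G X = \<lparr>verts = verts G \<inter> X, edges = {e \<in> edges G. e \<subseteq> X}\<rparr>"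

definition delete_vertex :: "'a ugraph \<Rightarrow> 'a \<Rightarrow> 'a ugraph" where
  "delete_vertex G v = induced G (- {v})"

text \<open>A cycle is given by the list of its vertices in cyclic order, so the length of the list
  is the length of the cycle.\<close>

definition is_cycle :: "'a ugraph \<Rightarrow> 'a list \<Rightarrow> bool" where
  "is_cycle G c \<longleftrightarrow>
     length c \<ge> 3 \<and> distinct c \<and> set c \<subseteq> verts G \<and>
     (\<forall>i<length c. {c ! i, c ! (Suc i mod length c)} \<in> edges G)"

definition single_edge :: "'a ugraph \<Rightarrow> bool" where
  "single_edge G \<longleftrightarrow> (\<exists>u v. u \<noteq> v \<and> verts G = {u, v} \<and> edges G = {{u, v}})"


section \<open>Local cutvertices\<close>

text \<open>The ball $B_s(v)$ for an integer $s$.\<close>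

definition ball_int :: "'a ugraph \<Rightarrow> nat \<Rightarrow> 'a \<Rightarrow> 'a ugraph" where
  "ball_int G s v =
     \<lparr>verts = {u \<in> verts G. gdist G v u \<le> enat s},
      edges = {e \<in> edges G. (\<forall>u\<in>e. gdist G v u \<le> enat s) \<and> \<not> (\<forall>u\<in>e. gdist G v u = enat s)}\<rparr>"

text \<open>The ball $B_{s+1/2}(v)$.\<close>

definition ball_half :: "'a ugraph \<Rightarrow> nat \<Rightarrow> 'a \<Rightarrow> 'a ugraph" where
  "ball_half G s v = induced G {u. gdist G v u \<le> enat s}"

text \<open>The ball $B_{r/2}(v)$; for $r = \infty$ it is the component of $v$.\<close>

definition ball_diam :: "'a ugraph \<Rightarrow> enat \<Rightarrow> 'a \<Rightarrow> 'a ugraph" where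
  "ball_diam G r v =
     (case r of
        enat n \<Rightarrow> if even n then ball_int G (n div 2) v else ball_half G (n div 2) v
      | \<infinity> \<Rightarrow> induced G {u. gdist G v u < \<infinity>})"

definition local_cutvertex :: "enat \<Rightarrow> 'a ugraph \<Rightarrow> 'a \<Rightarrow> bool" where
  "local_cutvertex r G v \<longleftrightarrow> v \<in> verts G \<and> disconnected_graph (delete_vertex (ball_diam G r v) v)"

definition locally_2_connected :: "enat \<Rightarrow> 'a ugraph \<Rightarrow> bool" where
  "locally_2_connected r G \<longleftrightarrow>
     connected_graph G \<and> (\<nexists>v. local_cutvertex r G v) \<and>
     (\<exists>c. is_cycle G c \<and> enat (length c) \<le> r)"


section \<open>Graph-decompositions\<close>

text \<open>The edges of the bipartite decomposition graph are the \<open>links\<close>; link \<open>f\<close> joins the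
  separator node \<open>sep_of f\<close> to the bag node \<open>bag_of f\<close>. Parallel links are allowed: the same
  local separator may be attached several times, at different places, to the same bag.\<close>

record ('b, 's, 'f, 'v, 'w) graph_dec =
  bags :: "'b set"
  seps :: "'s set"
  links :: "'f set"
  sep_of :: "'f \<Rightarrow> 's"
  bag_of :: "'f \<Rightarrow> 'b"
  bag_graph :: "'b \<Rightarrow> 'v ugraph"
  sep_graph :: "'s \<Rightarrow> 'w ugraph"
  emb :: "'f \<Rightarrow> 'w \<Rightarrow> 'v"

definition embedding :: "'w ugraph \<Rightarrow> 'v ugraph \<Rightarrow> ('w \<Rightarrow> 'v) \<Rightarrow> bool" where
  "embedding H G h \<longleftrightarrow>
     inj_on h (verts H) \<and> h ` verts H \<subseteq> verts G \<and> (\<forall>e\<in>edges H. h ` e \<in> edges G)"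

definition wf_dec :: "('b, 's, 'f, 'v, 'w) graph_dec \<Rightarrow> bool" where
  "wf_dec D \<longleftrightarrow>
     (\<forall>b\<in>bags D. wf_graph (bag_graph D b)) \<and>
     (\<forall>s\<in>seps D. wf_graph (sep_graph D s)) \<and>
     (\<forall>f\<in>links D. sep_of D f \<in> seps D \<and> bag_of D f \<in> bags D \<and>
        embedding (sep_graph D (sep_of D f)) (bag_graph D (bag_of D f)) (emb D f))"

text \<open>The underlying graph, a quotient of the disjoint union of the bags. It may have loops and
  parallel edges, so its edges are classes of edges of the disjoint union, and \<open>u_ends\<close> maps
  such a class to the set of its endvertices. The relations \<open>v_glue\<close> and \<open>e_glue\<close> are symmetric,
  so their reflexive transitive closures are equivalences.\<close>

definition sum_verts :: "('b, 's, 'f, 'v, 'w) graph_dec \<Rightarrow> ('b \<times> 'v) set" where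
  "sum_verts D = (SIGMA b:bags D. verts (bag_graph D b))"

definition sum_edges :: "('b, 's, 'f, 'v, 'w) graph_dec \<Rightarrow> ('b \<times> 'v set) set" where
  "sum_edges D = (SIGMA b:bags D. edges (bag_graph D b))"

definition v_glue :: "('b, 's, 'f, 'v, 'w) graph_dec \<Rightarrow> ('b \<times> 'v) rel" where
  "v_glue D = {((bag_of D f, emb D f x), (bag_of D g, emb D g x)) | f g x.
     f \<in> links D \<and> g \<in> links D \<and> sep_of D f = sep_of D g \<and>
     x \<in> verts (sep_graph D (sep_of D f))}"

definition e_glue :: "('b, 's, 'f, 'v, 'w) graph_dec \<Rightarrow> ('b \<times> 'v set) rel" where
  "e_glue D = {((bag_of D f, emb D f ` e), (bag_of D g, emb D g ` e)) | f g e.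
     f \<in> links D \<and> g \<in> links D \<and> sep_of D f = sep_of D g \<and>
     e \<in> edges (sep_graph D (sep_of D f))}"

definition v_class :: "('b, 's, 'f, 'v, 'w) graph_dec \<Rightarrow> 'b \<times> 'v \<Rightarrow> ('b \<times> 'v) set" where
  "v_class D p = (v_glue D)\<^sup>* `` {p}"

definition u_verts :: "('b, 's, 'f, 'v, 'w) graph_dec \<Rightarrow> ('b \<times> 'v) set set" where
  "u_verts D = sum_verts D // (v_glue D)\<^sup>*"

definition u_edges :: "('b, 's, 'f, 'v, 'w) graph_dec \<Rightarrow> ('b \<times> 'v set) set set" where
  "u_edges D = sum_edges D // (e_glue D)\<^sup>*"

definition u_ends ::
  "('b, 's, 'f, 'v, 'w) graph_dec \<Rightarrow> ('b \<times> 'v set) set \<Rightarrow> ('b \<times> 'v) set set" where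
  "u_ends D X = {v_class D (b, x) | b e x. (b, e) \<in> X \<and> x \<in> e}"

text \<open>\<open>D\<close> is a graph-decomposition of \<open>G\<close>, where \<open>\<phi>\<close> is the isomorphism identifying the
  underlying graph with \<open>G\<close>. As \<open>G\<close> is simple, an edge of \<open>G\<close> is the set of its endvertices, so
  \<open>\<phi>\<close> determines the bijection between the edges.\<close>

definition graph_decomposition_of ::
  "('b, 's, 'f, 'v, 'w) graph_dec \<Rightarrow> (('b \<times> 'v) set \<Rightarrow> 'a) \<Rightarrow> 'a ugraph \<Rightarrow> bool" where
  "graph_decomposition_of D \<phi> G \<longleftrightarrow>
     wf_dec D \<and> bij_betw \<phi> (u_verts D) (verts G) \<and>
     bij_betw (\<lambda>X. \<phi> ` u_ends D X) (u_edges D) (edges G)"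

text \<open>The maximum of the orders of the local separators is attained and equals \<open>k\<close>.\<close>

definition has_adhesion :: "('b, 's, 'f, 'v, 'w) graph_dec \<Rightarrow> nat \<Rightarrow> bool" where
  "has_adhesion D k \<longleftrightarrow>
     (\<forall>s\<in>seps D. finite (verts (sep_graph D s)) \<and> card (verts (sep_graph D s)) \<le> k) \<and>
     (\<exists>s\<in>seps D. card (verts (sep_graph D s)) = k)"


section \<open>Locality\<close>

definition links_at :: "('b, 's, 'f, 'v, 'w) graph_dec \<Rightarrow> 's \<Rightarrow> 'f set" where
  "links_at D s = {f \<in> links D. sep_of D f = s}"

definition link_image :: "('b, 's, 'f, 'v, 'w) graph_dec \<Rightarrow> 'f \<Rightarrow> ('b \<times> 'v) set" where
  "link_image D f = (\<lambda>x. (bag_of D f, emb D f x)) ` verts (sep_graph D (sep_of D f))"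

text \<open>The vertex of \<open>G\<close> represented by a vertex of a bag, and the vertices of \<open>G\<close> in the local
  separator \<open>s\<close>.\<close>

definition proj ::
  "('b, 's, 'f, 'v, 'w) graph_dec \<Rightarrow> (('b \<times> 'v) set \<Rightarrow> 'a) \<Rightarrow> 'b \<times> 'v \<Rightarrow> 'a" where
  "proj D \<phi> p = \<phi> (v_class D p)"

definition sep_verts ::
  "('b, 's, 'f, 'v, 'w) graph_dec \<Rightarrow> (('b \<times> 'v) set \<Rightarrow> 'a) \<Rightarrow> 's \<Rightarrow> 'a set" where
  "sep_verts D \<phi> s = (\<Union>f\<in>links_at D s. proj D \<phi> ` link_image D f)"

text \<open>The edge \<open>e\<close> of \<open>G\<close> has label \<open>f\<close> at \<open>s\<close> if some edge of the bag of \<open>f\<close> representing \<open>e\<close>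
  has an endvertex in the image of the embedding belonging to \<open>f\<close>.\<close>

definition has_label ::
  "('b, 's, 'f, 'v, 'w) graph_dec \<Rightarrow> (('b \<times> 'v) set \<Rightarrow> 'a) \<Rightarrow> 's \<Rightarrow> 'a set \<Rightarrow> 'f \<Rightarrow> bool" where
  "has_label D \<phi> s e f \<longleftrightarrow>
     f \<in> links_at D s \<and>
     (\<exists>e'\<in>edges (bag_graph D (bag_of D f)).
        (\<lambda>y. proj D \<phi> (bag_of D f, y)) ` e' = e \<and>
        (\<exists>y\<in>e'. (bag_of D f, y) \<in> link_image D f))"

definition edge_label ::
  "('b, 's, 'f, 'v, 'w) graph_dec \<Rightarrow> (('b \<times> 'v) set \<Rightarrow> 'a) \<Rightarrow> 's \<Rightarrow> 'a set \<Rightarrow> 'f" where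
  "edge_label D \<phi> s e = (THE f. has_label D \<phi> s e f)"

definition labelling_well_defined ::
  "('b, 's, 'f, 'v, 'w) graph_dec \<Rightarrow> (('b \<times> 'v) set \<Rightarrow> 'a) \<Rightarrow> 'a ugraph \<Rightarrow> bool" where
  "labelling_well_defined D \<phi> G \<longleftrightarrow>
     (\<forall>s\<in>seps D.
        (\<forall>f\<in>links_at D s. \<forall>g\<in>links_at D s. f \<noteq> g \<longrightarrow> link_image D f \<inter> link_image D g = {}) \<and>
        (\<forall>u\<in>sep_verts D \<phi> s. \<forall>w. w \<notin> sep_verts D \<phi> s \<longrightarrow> {u, w} \<in> edges G \<longrightarrow>
           (\<exists>!f. has_label D \<phi> s {u, w} f)))"

text \<open>A traversal is encoded by the position \<open>i\<close> of its first vertex on the cycle and its number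
  \<open>k\<close> of vertices. Its maximality says that the vertices \<open>c ! ((i + n - 1) mod n)\<close> and
  \<open>c ! ((i + k) mod n)\<close> just before and after it are not in the separator. A cycle entirely
  inside the separator has no preceding and succeeding edges with labels, hence no traversal.\<close>

definition traversals ::
  "('b, 's, 'f, 'v, 'w) graph_dec \<Rightarrow> (('b \<times> 'v) set \<Rightarrow> 'a) \<Rightarrow> 's \<Rightarrow> 'a list \<Rightarrow> (nat \<times> nat) set"
where
  "traversals D \<phi> s c =
     (let n = length c; vx = (\<lambda>j. c ! (j mod n)) in
      {(i, k). i < n \<and> 1 \<le> k \<and> k < n \<and>
         (\<forall>j<k. vx (i + j) \<in> sep_verts D \<phi> s) \<and>
         vx (i + n - 1) \<notin> sep_verts D \<phi> s \<and>
         vx (i + k) \<notin> sep_verts D \<phi> s \<and>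
         edge_label D \<phi> s {vx (i + n - 1), vx i} \<noteq>
         edge_label D \<phi> s {vx (i + k - 1), vx (i + k)}})"

definition has_locality ::
  "('b, 's, 'f, 'v, 'w) graph_dec \<Rightarrow> (('b \<times> 'v) set \<Rightarrow> 'a) \<Rightarrow> 'a ugraph \<Rightarrow> enat \<Rightarrow> bool" where
  "has_locality D \<phi> G r \<longleftrightarrow>
     labelling_well_defined D \<phi> G \<and>
     (\<forall>c. is_cycle G c \<longrightarrow> (\<exists>s\<in>seps D. odd (card (traversals D \<phi> s c))) \<longrightarrow>
        r < enat (length c))"

end

theory Submission
  imports Defs
begin

text \<open>At every vertex \<open>v\<close>, let two neighbours be equivalent if they are linked by a chain in which
  consecutive members are the two neighbours of \<open>v\<close> on some cycle of length at most \<open>r\<close>. Split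
  each vertex into one copy per equivalence class of neighbours; the components of the resulting
  graph are the bags, and each vertex of the original graph is a local separator linked to its
  copies. A cycle of length at most \<open>r\<close> never changes copies at a vertex, which gives the
  locality, and it lifts to the split graph. Hence at each vertex \<open>x\<close> of a bag all neighbours are
  linked by a chain of short cycles through \<open>x\<close>. These cycles lie in the ball of diameter \<open>r\<close>
  around \<open>x\<close>, so \<open>x\<close> is not a local cutvertex. If no cycle of length at most \<open>r\<close> lifts to a
  bag, then all classes in it are singletons, so all its vertices have degree one and it is an edge.\<close>

section \<open>Walks, components and cycles\<close>

text \<open>Both ends are required to be vertices so that reachability agrees with
  \<open>walk\<close> in every \<open>ugraph\<close>, well-formed or not.\<close>

definition adj :: "'a ugraph \<Rightarrow> 'a rel" where
  "adj G = {(x, y). x \<in> verts G \<and> y \<in> verts G \<and> {x, y} \<in> edges G}"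

definition component :: "'a ugraph \<Rightarrow> 'a \<Rightarrow> 'a set" where
  "component G x = (adj G)\<^sup>* `` {x}"

lemma sym_adj_rtrancl: "sym ((adj G)\<^sup>*)"
  by (rule sym_rtrancl) (auto simp: sym_def adj_def insert_commute)

lemma component_subset_verts: "x \<in> verts G \<Longrightarrow> component G x \<subseteq> verts G"
proof
  fix y assume x: "x \<in> verts G" and "y \<in> component G x"
  then have "(x, y) \<in> (adj G)\<^sup>*" by (simp add: component_def)
  then show "y \<in> verts G" by (induction) (auto simp: x adj_def)
qed

lemma self_in_component: "x \<in> component G x"
  by (simp add: component_def)

lemma component_eq: "y \<in> component G x \<Longrightarrow> component G y = component G x"
  using sym_adj_rtrancl[of G] by (auto simp: component_def dest: symD intro: rtrancl_trans)

lemma walk_snoc: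
  "walk G p u v \<Longrightarrow> w \<in> verts G \<Longrightarrow> {v, w} \<in> edges G \<Longrightarrow> walk G (p @ [w]) u w"
  by (auto simp: walk_def successively_append_iff)

lemma walk_snocD:
  assumes "walk G (p @ [w]) u v" and "p \<noteq> []"
  shows "w = v" "v \<in> verts G" "walk G p u (last p)" "{last p, v} \<in> edges G" "last p \<in> verts G"
  using assms by (auto simp: walk_def successively_append_iff)

text \<open>Replaces lists by a closure, so that connectivity can be proved by chaining steps. The
  condition on \<open>u\<close> remains because the reflexive closure relates even non-vertices to
  themselves.\<close>

lemma walk_exists_iff: "(\<exists>p. walk G p u v) \<longleftrightarrow> u \<in> verts G \<and> (u, v) \<in> (adj G)\<^sup>*"
proof
  assume "\<exists>p. walk G p u v"
  then obtain p where "walk G p u v" ..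
  then show "u \<in> verts G \<and> (u, v) \<in> (adj G)\<^sup>*"
  proof (induction p arbitrary: v rule: rev_induct)
    case Nil
    then show ?case by (simp add: walk_def)
  next
    case (snoc w p)
    show ?case
    proof (cases "p = []")
      case True
      with snoc.prems show ?thesis by (auto simp: walk_def)
    next
      case False
      note w = walk_snocD[OF snoc.prems False]
      have "(last p, v) \<in> adj G" using w by (auto simp: adj_def)
      with snoc.IH[OF w(3)] show ?thesis by (auto intro: rtrancl_into_rtrancl)
    qed
  qed
next
  assume "u \<in> verts G \<and> (u, v) \<in> (adj G)\<^sup>*"
  then have u: "u \<in> verts G" and "(u, v) \<in> (adj G)\<^sup>*" by auto
  from this(2) show "\<exists>p. walk G p u v"
  proof (induction)
    case base
    have "walk G [u] u u" using u by (simp add: walk_def)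
    then show ?case ..
  next
    case (step y z)
    then obtain p where "walk G p u y" by blast
    then have "walk G (p @ [z]) u z" using step by (intro walk_snoc) (auto simp: adj_def)
    then show ?case ..
  qed
qed

lemma disconnected_graph_iff:
  "disconnected_graph G \<longleftrightarrow> (\<exists>u\<in>verts G. \<exists>v\<in>verts G. (u, v) \<notin> (adj G)\<^sup>*)"
  unfolding disconnected_graph_def walk_exists_iff by auto

lemma connected_component:
  assumes "x \<in> verts G"
  shows "connected_graph (induced G (component G x))"
proof -
  let ?H = "induced G (component G x)"
  have V: "verts ?H = component G x"
    using component_subset_verts[OF assms] by (auto simp: induced_def)
  \<comment> \<open>Every member of a chain from \<open>x\<close> lies in the component of
    \<open>x\<close>, so each step survives the restriction.\<close>
  have reach: "(x, y) \<in> (adj ?H)\<^sup>*" if "(x, y) \<in> (adj G)\<^sup>*" for y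
    using that
  proof (induction)
    case (step y z)
    then have "y \<in> component G x" "z \<in> component G x"
      by (auto simp: component_def intro: rtrancl_into_rtrancl)
    with step(2) have "(y, z) \<in> adj ?H" by (auto simp: adj_def induced_def)
    with step show ?case by (auto intro: rtrancl_into_rtrancl)
  qed simp
  have "(u, v) \<in> (adj ?H)\<^sup>*" if "u \<in> verts ?H" "v \<in> verts ?H" for u v
  proof -
    have "(x, u) \<in> (adj ?H)\<^sup>*" "(x, v) \<in> (adj ?H)\<^sup>*"
      using that V reach by (auto simp: component_def)
    then show ?thesis
      using symD[OF sym_adj_rtrancl] rtrancl_trans by metis
  qed
  moreover have "verts ?H \<noteq> {}" using V self_in_component by fastforce
  ultimately show ?thesis
    unfolding connected_graph_def disconnected_graph_iff by blast
qed

section \<open>Well-formed graphs and cycles as lists\<close>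

lemma wf_graph_induced: "wf_graph G \<Longrightarrow> wf_graph (induced G X)"
  by (auto simp: wf_graph_def induced_def)

lemma wf_graph_edgeD:
  assumes "wf_graph G" "{x, y} \<in> edges G"
  shows "x \<in> verts G" "y \<in> verts G" "x \<noteq> y"
proof -
  have *: "{x, y} \<subseteq> verts G" "card {x, y} = 2" using assms unfolding wf_graph_def by blast+
  then show "x \<in> verts G" "y \<in> verts G" by auto
  show "x \<noteq> y" using *(2) by auto
qed

text \<open>Allows any vertex of a cycle to be moved to the front, the position that
  \<open>short_cycle_rel\<close> singles out.\<close>

lemma is_cycle_rotate:
  assumes "is_cycle G c"
  shows "is_cycle G (rotate k c)"
proof -
  have n: "0 < length c" using assms by (auto simp: is_cycle_def)
  have "{rotate k c ! i, rotate k c ! (Suc i mod length c)} \<in> edges G" if "i < length c" for i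
  proof -
    have "{c ! ((k + i) mod length c), c ! (Suc ((k + i) mod length c) mod length c)} \<in> edges G"
      using assms n by (auto simp: is_cycle_def)
    then show ?thesis using that n by (simp add: nth_rotate mod_simps)
  qed
  then show ?thesis using assms by (simp add: is_cycle_def)
qed

lemma is_cycle_ConsD:
  assumes "is_cycle G (v # p)"
  shows "p \<noteq> []" "v \<in> verts G" "v \<notin> set p" "distinct p" "set p \<subseteq> verts G"
    "{v, hd p} \<in> edges G" "{last p, v} \<in> edges G" "2 \<le> length p"
    "\<And>j. Suc j < length p \<Longrightarrow> {p ! j, p ! Suc j} \<in> edges G"
proof -
  have *: "length (v # p) \<ge> 3" "distinct (v # p)" "set (v # p) \<subseteq> verts G"
    and e: "\<And>i. i < Suc (length p) \<Longrightarrow> {(v # p) ! i, (v # p) ! (Suc i mod Suc (length p))} \<in> edges G"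
    using assms by (auto simp: is_cycle_def)
  then show p: "p \<noteq> []" "v \<in> verts G" "v \<notin> set p" "distinct p" "set p \<subseteq> verts G" "2 \<le> length p"
    by auto
  show "{v, hd p} \<in> edges G" using e[of 0] p by (simp add: hd_conv_nth)
  show "{last p, v} \<in> edges G" using e[of "length p"] p by (simp add: last_conv_nth nth_Cons')
  show "{p ! j, p ! Suc j} \<in> edges G" if "Suc j < length p" for j using e[of "Suc j"] that by simp
qed


section \<open>Short cycles through a vertex\<close>

text \<open>The two neighbours of \<open>v\<close> on the cycle \<open>v # p\<close> are the ends of
  \<open>p\<close>. Admitting both orders makes the relation symmetric, so its closure is an
  equivalence.\<close>

definition short_cycle_rel :: "enat \<Rightarrow> 'a ugraph \<Rightarrow> 'a \<Rightarrow> 'a rel" where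
  "short_cycle_rel r G v = {(x, y). \<exists>p. is_cycle G (v # p) \<and> enat (Suc (length p)) \<le> r \<and>
     (x = hd p \<and> y = last p \<or> x = last p \<and> y = hd p)}"

text \<open>Through reflexivity, a neighbour that lies on no short cycle with \<open>v\<close> forms
  a class of its own.\<close>

definition nbr_class :: "enat \<Rightarrow> 'a ugraph \<Rightarrow> 'a \<Rightarrow> 'a \<Rightarrow> 'a set" where
  "nbr_class r G v x = (short_cycle_rel r G v)\<^sup>* `` {x}"

lemma sym_short_cycle_rel_rtrancl: "sym ((short_cycle_rel r G v)\<^sup>*)"
  by (rule sym_rtrancl) (auto simp: sym_def short_cycle_rel_def)

lemma nbr_class_eq: "y \<in> nbr_class r G v x \<Longrightarrow> nbr_class r G v y = nbr_class r G v x"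
  using sym_short_cycle_rel_rtrancl[of r G v]
  by (auto simp: nbr_class_def dest: symD intro: rtrancl_trans)

lemma self_in_nbr_class: "x \<in> nbr_class r G v x"
  by (simp add: nbr_class_def)

text \<open>Rotation by \<open>i\<close> turns the successor and the predecessor of position
  \<open>i\<close> into the two ends of the remaining path. The summand \<open>length c\<close>
  keeps the predecessor index meaningful at \<open>i = 0\<close>, where subtraction would
  truncate.\<close>

lemma short_cycle_rel_nth:
  assumes "is_cycle G c" "enat (length c) \<le> r" "i < length c"
  shows "(c ! ((i + length c - 1) mod length c), c ! (Suc i mod length c))
    \<in> short_cycle_rel r G (c ! i)"
proof -
  let ?n = "length c" and ?d = "rotate i c"
  have n: "3 \<le> ?n" using assms(1) by (simp add: is_cycle_def)
  obtain v p where d: "?d = v # p" using n by (cases ?d) auto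
  have l: "length p = ?n - 1" using d by (metis length_rotate length_Cons diff_Suc_1)
  have cyc: "is_cycle G (v # p)" using is_cycle_rotate[OF assms(1), of i] d by simp
  have nth: "(v # p) ! j = c ! ((i + j) mod ?n)" if "j < ?n" for j
    using nth_rotate[of j c i] that d by simp
  have "v = c ! i" using nth[of 0] assms(3) by fastforce
  moreover have "hd p = c ! (Suc i mod ?n)"
    using nth[of 1] n l by (cases p) auto
  moreover have "last p = c ! ((i + ?n - 1) mod ?n)"
  proof -
    have "last p = (v # p) ! (?n - 1)"
      using l n by (subst last_conv_nth) (auto simp: nth_Cons')
    then show ?thesis using nth[of "?n - 1"] n by simp
  qed
  moreover have "enat (Suc (length p)) \<le> r" using assms(2) l n
    by (metis Suc_diff_1 not_numeral_le_zero not_gr_zero)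
  ultimately show ?thesis using cyc by (auto simp: short_cycle_rel_def intro!: exI[of _ p])
qed


section \<open>Balls\<close>

text \<open>A finite bound excludes the empty infimum \<infinity>, and a nonempty set of extended
  naturals attains its infimum. The \<open>Suc\<close> arises because \<open>length p\<close> counts
  vertices rather than edges.\<close>

lemma gdist_le_iff: "gdist G u v \<le> enat d \<longleftrightarrow> (\<exists>p. walk G p u v \<and> length p \<le> Suc d)"
proof
  assume *: "gdist G u v \<le> enat d"
  let ?A = "(\<lambda>p. enat (length p - 1)) ` {p. walk G p u v}"
  have "?A \<noteq> {}"
  proof
    assume "?A = {}"
    then have "gdist G u v = \<infinity>" unfolding gdist_def by (metis Inf_empty top_enat_def)
    then show False using * by simp
  qed
  then have "gdist G u v \<in> ?A" unfolding gdist_def by (metis LeastI Inf_enat_def ex_in_conv)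
  then show "\<exists>p. walk G p u v \<and> length p \<le> Suc d" using * by auto
next
  assume "\<exists>p. walk G p u v \<and> length p \<le> Suc d"
  then obtain p where p: "walk G p u v" "length p \<le> Suc d" by blast
  then have "gdist G u v \<le> enat (length p - 1)" unfolding gdist_def by (intro INF_lower) simp
  also have "\<dots> \<le> enat d" using p by simp
  finally show "gdist G u v \<le> enat d" .
qed

lemma gdist_self: "v \<in> verts G \<Longrightarrow> gdist G v v \<le> enat 0"
  unfolding gdist_le_iff by (rule exI[of _ "[v]"]) (simp add: walk_def)

lemma gdist_step:
  assumes "gdist G v a \<le> enat d" "wf_graph G" "{a, b} \<in> edges G"
  shows "gdist G v b \<le> enat (Suc d)"
proof -
  obtain p where "walk G p v a" "length p \<le> Suc d" using assms(1) unfolding gdist_le_iff by auto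
  then have "walk G (p @ [b]) v b" "length (p @ [b]) \<le> Suc (Suc d)"
    using walk_snoc[of G p v a b] wf_graph_edgeD[OF assms(2,3)] assms(3) by auto
  then show ?thesis unfolding gdist_le_iff by auto
qed

text \<open>One description for even, odd and infinite \<open>r\<close>: for
  \<open>r = enat n\<close> the best radius is \<open>n div 2\<close>, while for \<infinity> every
  finite radius is allowed.\<close>

lemma ball_diam_verts:
  "u \<in> verts (ball_diam G r v) \<longleftrightarrow>
    u \<in> verts G \<and> (\<exists>d. gdist G v u \<le> enat d \<and> enat (2 * d) \<le> r)"
proof (cases r)
  case (enat n)
  have "(\<exists>d. gdist G v u \<le> enat d \<and> 2 * d \<le> n) \<longleftrightarrow> gdist G v u \<le> enat (n div 2)"
  proof
    assume "\<exists>d. gdist G v u \<le> enat d \<and> 2 * d \<le> n"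
    then obtain d where "gdist G v u \<le> enat d" "2 * d \<le> n" by blast
    moreover from this have "enat d \<le> enat (n div 2)" by simp
    ultimately show "gdist G v u \<le> enat (n div 2)" by (meson order_trans)
  qed (auto intro: exI[of _ "n div 2"])
  then show ?thesis using enat by (auto simp: ball_diam_def ball_int_def ball_half_def induced_def)
next
  case infinity
  have "gdist G v u < \<infinity> \<longleftrightarrow> (\<exists>d. gdist G v u \<le> enat d)"
    by (cases "gdist G v u") auto
  then show ?thesis using infinity by (auto simp: ball_diam_def induced_def)
qed

text \<open>The bounds on \<open>2 * i\<close> and \<open>2 * j\<close> keep the ends in the ball.
  The bound on \<open>Suc (i + j)\<close> protects the edge for even \<open>r = n\<close>: were both
  ends at distance exactly \<open>n div 2\<close>, then \<open>i + j\<close> would be at least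
  \<open>n\<close>.\<close>

lemma ball_diam_edge:
  assumes "{a, b} \<in> edges G" "gdist G v a \<le> enat i" "gdist G v b \<le> enat j"
    "enat (2 * i) \<le> r" "enat (2 * j) \<le> r" "enat (Suc (i + j)) \<le> r"
  shows "{a, b} \<in> edges (ball_diam G r v)"
proof (cases r)
  case (enat n)
  then have n: "i \<le> n div 2" "j \<le> n div 2" "Suc (i + j) \<le> n" using assms by auto
  have a: "gdist G v a \<le> enat (n div 2)" and b: "gdist G v b \<le> enat (n div 2)"
    using assms(2,3) n by (meson enat_ord_simps(1) order_trans)+
  have "\<not> (gdist G v a = enat (n div 2) \<and> gdist G v b = enat (n div 2))" if "even n"
    using assms(2,3) n that by auto
  then show ?thesis using a b enat assms(1)
    by (auto simp: ball_diam_def ball_int_def ball_half_def induced_def)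
next
  case infinity
  have "gdist G v a < \<infinity>" "gdist G v b < \<infinity>"
    by (rule order.strict_trans1[OF assms(2)], simp) (rule order.strict_trans1[OF assms(3)], simp)
  then show ?thesis using infinity assms(1) by (auto simp: ball_diam_def induced_def)
qed

section \<open>Connectivity of punctured balls\<close>

lemma punctured_ball_adj:
  assumes "wf_graph G" "{a, b} \<in> edges G" "gdist G v a \<le> enat i" "gdist G v b \<le> enat j"
    "enat (2 * i) \<le> r" "enat (2 * j) \<le> r" "enat (Suc (i + j)) \<le> r" "a \<noteq> v" "b \<noteq> v"
  shows "(a, b) \<in> adj (delete_vertex (ball_diam G r v) v)"
proof -
  have "{a, b} \<in> edges (ball_diam G r v)" using assms by (intro ball_diam_edge)
  moreover have "a \<in> verts (ball_diam G r v)" "b \<in> verts (ball_diam G r v)"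
    using assms wf_graph_edgeD[OF assms(1,2)] unfolding ball_diam_verts by blast+
  ultimately show ?thesis
    using assms(8,9) by (auto simp: adj_def delete_vertex_def induced_def)
qed

text \<open>The path left after removing \<open>v\<close> from a short cycle lies entirely in the
  punctured ball, since each of its vertices can be reached from \<open>v\<close> along the shorter
  side of the cycle.\<close>

lemma short_cycle_rel_connected:
  assumes wf: "wf_graph G" and xy: "(x, y) \<in> short_cycle_rel r G v"
  shows "(x, y) \<in> (adj (delete_vertex (ball_diam G r v) v))\<^sup>*"
proof -
  let ?R = "adj (delete_vertex (ball_diam G r v) v)"
  obtain p where cyc: "is_cycle G (v # p)" and len: "enat (Suc (length p)) \<le> r"
    and p: "x = hd p \<and> y = last p \<or> x = last p \<and> y = hd p"
    using xy unfolding short_cycle_rel_def by blast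
  note c = is_cycle_ConsD[OF cyc]
  let ?m = "length p"
  have up: "gdist G v (p ! j) \<le> enat (Suc j)" if "j < ?m" for j
    using that
  proof (induction j)
    case 0
    show ?case
      using gdist_step[OF gdist_self[OF c(2)] wf c(6)] c(1) by (simp add: hd_conv_nth)
  next
    case (Suc j)
    then show ?case by (intro gdist_step[OF Suc.IH wf c(9)]) auto
  qed
  \<comment> \<open>Distances along the other side of the cycle; the index counts from the end of
    \<open>p\<close> so that the induction again starts next to \<open>v\<close>.\<close>
  have down: "gdist G v (p ! (?m - Suc j)) \<le> enat (Suc j)" if "j < ?m" for j
    using that
  proof (induction j)
    case 0
    have "{v, last p} \<in> edges G" using c(7) by (simp add: insert_commute)
    from gdist_step[OF gdist_self[OF c(2)] wf this] show ?case
      using c(1) by (simp add: last_conv_nth)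
  next
    case (Suc j)
    have "{p ! (?m - Suc (Suc j)), p ! Suc (?m - Suc (Suc j))} \<in> edges G"
      using Suc.prems by (intro c(9)) auto
    moreover have "Suc (?m - Suc (Suc j)) = ?m - Suc j" using Suc.prems by simp
    ultimately have "{p ! (?m - Suc j), p ! (?m - Suc (Suc j))} \<in> edges G"
      by (simp add: insert_commute)
    with Suc show ?case by (intro gdist_step[OF Suc.IH wf]) auto
  qed
  have down': "gdist G v (p ! j) \<le> enat (?m - j)" if "j < ?m" for j
  proof -
    have "?m - Suc (?m - Suc j) = j" "Suc (?m - Suc j) = ?m - j" using that by auto
    then show ?thesis using down[of "?m - Suc j"] that by simp
  qed
  have dist: "gdist G v (p ! j) \<le> enat (min (Suc j) (?m - j))" if "j < ?m" for j
    using up[OF that] down'[OF that] by (simp add: min_def)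
  have le_r: "enat k \<le> r" if "k \<le> Suc ?m" for k
    using len that by (meson enat_ord_simps(1) order_trans)
  \<comment> \<open>Bounding the distance of \<open>p ! j\<close> from the front by
    \<open>Suc j\<close> and that of \<open>p ! Suc j\<close> from the back by
    \<open>?m - Suc j\<close> gives a sum of at most \<open>?m\<close>, one less than the length of
    the cycle.\<close>
  have step: "(p ! j, p ! Suc j) \<in> ?R" if "Suc j < ?m" for j
  proof (rule punctured_ball_adj[OF wf c(9)[OF that] dist dist])
    show "p ! j \<noteq> v" "p ! Suc j \<noteq> v" using c(3) that by (auto simp: in_set_conv_nth)
  qed (use that in \<open>auto intro!: le_r simp: min_def\<close>)
  have "(p ! 0, p ! j) \<in> ?R\<^sup>*" if "j < ?m" for j
    using that
  proof (induction j)
    case (Suc j)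
    then have "(p ! 0, p ! j) \<in> ?R\<^sup>*" by simp
    with step[OF Suc.prems] show ?case by (rule rtrancl_into_rtrancl[rotated])
  qed simp
  from this[of "?m - 1"] have "(hd p, last p) \<in> ?R\<^sup>*"
    using c(1) by (simp add: hd_conv_nth last_conv_nth)
  then show ?thesis using p symD[OF sym_adj_rtrancl] by metis
qed

text \<open>Trace the walk back from \<open>u\<close> to its last visit to \<open>v\<close>: the
  part after this visit avoids \<open>v\<close>, stays in the ball and starts at a neighbour of
  \<open>v\<close>.\<close>

lemma punctured_ball_reaches_nbr:
  assumes wf: "wf_graph G" and w: "walk G p v u" and "length p \<le> Suc d" "u \<noteq> v" "enat (2 * d) \<le> r"
  shows "\<exists>x. {v, x} \<in> edges G \<and> (x, u) \<in> (adj (delete_vertex (ball_diam G r v) v))\<^sup>*"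
  using assms(2-)
proof (induction d arbitrary: p u)
  case 0
  then obtain a where "p = [a]" by (cases p) (auto simp: walk_def)
  with 0 show ?case by (auto simp: walk_def)
next
  case (Suc d)
  let ?R = "adj (delete_vertex (ball_diam G r v) v)"
  have "p \<noteq> []" using Suc.prems by (auto simp: walk_def)
  then obtain q a where p: "p = q @ [a]" by (cases p rule: rev_cases) auto
  have "q \<noteq> []"
  proof
    assume "q = []"
    then show False using Suc.prems p by (auto simp: walk_def)
  qed
  note w = walk_snocD[OF Suc.prems(1)[unfolded p] this]
  have d: "enat (2 * d) \<le> r"
    by (rule order_trans[OF _ Suc.prems(4)]) simp
  show ?case
  proof (cases "last q = v")
    case True
    then show ?thesis using w by auto
  next
    case False
    have l: "length q \<le> Suc d" using Suc.prems(2) p by simp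
    obtain x where x: "{v, x} \<in> edges G" "(x, last q) \<in> ?R\<^sup>*"
      using Suc.IH[OF w(3) l False d] by blast
    have "gdist G v (last q) \<le> enat d" using w(3) l unfolding gdist_le_iff by auto
    moreover have "gdist G v u \<le> enat (Suc d)" using Suc.prems(1,2) unfolding gdist_le_iff by auto
    \<comment> \<open>An edge between distance bounds \<open>d\<close> and \<open>Suc d\<close>
      needs exactly \<open>2 * Suc d\<close>, which is the hypothesis on the radius.\<close>
    moreover have "enat (Suc (d + Suc d)) \<le> r" using Suc.prems(4) by (simp add: mult_2)
    ultimately have "(last q, u) \<in> ?R"
      using punctured_ball_adj[OF wf w(4)] d Suc.prems(3,4) False by blast
    with x show ?thesis by (auto intro: rtrancl_into_rtrancl)
  qed
qed

text \<open>Every vertex of the punctured ball reaches some neighbour of \<open>v\<close>, and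
  chains of short cycles connect the neighbours to each other.\<close>

lemma not_local_cutvertexI:
  assumes wf: "wf_graph G"
    and nbrs: "\<And>x y. {v, x} \<in> edges G \<Longrightarrow> {v, y} \<in> edges G \<Longrightarrow> (x, y) \<in> (short_cycle_rel r G v)\<^sup>*"
  shows "\<not> local_cutvertex r G v"
proof -
  let ?H = "delete_vertex (ball_diam G r v) v"
  have conn: "(x, y) \<in> (adj ?H)\<^sup>*" if "(x, y) \<in> (short_cycle_rel r G v)\<^sup>*" for x y
    using that
  proof (induction)
    case (step y z)
    show ?case by (rule rtrancl_trans[OF step.IH short_cycle_rel_connected[OF wf step(2)]])
  qed simp
  have reach: "\<exists>x. {v, x} \<in> edges G \<and> (x, u) \<in> (adj ?H)\<^sup>*" if "u \<in> verts ?H" for u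
  proof -
    have u: "u \<in> verts (ball_diam G r v)" "u \<noteq> v"
      using that by (auto simp: delete_vertex_def induced_def)
    then obtain d p where d: "enat (2 * d) \<le> r" and p: "walk G p v u" "length p \<le> Suc d"
      unfolding ball_diam_verts gdist_le_iff by blast
    show ?thesis by (rule punctured_ball_reaches_nbr[OF wf p u(2) d])
  qed
  have "(u, w) \<in> (adj ?H)\<^sup>*" if uw: "u \<in> verts ?H" "w \<in> verts ?H" for u w
  proof -
    obtain x y where "{v, x} \<in> edges G" "(x, u) \<in> (adj ?H)\<^sup>*"
      "{v, y} \<in> edges G" "(y, w) \<in> (adj ?H)\<^sup>*"
      using reach[OF uw(1)] reach[OF uw(2)] by blast
    then have "(u, x) \<in> (adj ?H)\<^sup>*" "(x, y) \<in> (adj ?H)\<^sup>*" "(y, w) \<in> (adj ?H)\<^sup>*"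
      using conn[OF nbrs] symD[OF sym_adj_rtrancl] by metis+
    then show ?thesis by simp
  qed
  then show ?thesis unfolding local_cutvertex_def disconnected_graph_iff by blast
qed


section \<open>The split graph\<close>

text \<open>The copy of \<open>v\<close> that faces its neighbour \<open>x\<close>. Naming it by a
  class makes it the same copy for all neighbours in that class.\<close>

definition split_vertex :: "enat \<Rightarrow> 'a ugraph \<Rightarrow> 'a \<Rightarrow> 'a \<Rightarrow> 'a \<times> 'a set" where
  "split_vertex r G v x = (v, nbr_class r G v x)"

text \<open>Each edge of \<open>G\<close> is kept once, between the copies of its ends that face
  each other. A vertex without neighbours has no copy.\<close>

definition split_graph :: "enat \<Rightarrow> 'a ugraph \<Rightarrow> ('a \<times> 'a set) ugraph" where
  "split_graph r G =
     \<lparr>verts = {split_vertex r G v x | v x. {v, x} \<in> edges G},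
      edges = {{split_vertex r G v x, split_vertex r G x v} | v x. {v, x} \<in> edges G}\<rparr>"

lemma fst_split_vertex [simp]: "fst (split_vertex r G v x) = v"
  by (simp add: split_vertex_def)

lemma split_vertex_eq_iff:
  "split_vertex r G v x = split_vertex r G w y \<longleftrightarrow> v = w \<and> nbr_class r G v x = nbr_class r G w y"
  by (auto simp: split_vertex_def)

lemma split_vertex_in_split_graph:
  "{v, x} \<in> edges G \<Longrightarrow> split_vertex r G v x \<in> verts (split_graph r G)"
  by (auto simp: split_graph_def)

lemma split_graph_vertsE:
  assumes "f \<in> verts (split_graph r G)"
  obtains v x where "f = split_vertex r G v x" "{v, x} \<in> edges G"
  using assms by (auto simp: split_graph_def)

lemma split_graph_edgesE:
  assumes "e \<in> edges (split_graph r G)"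
  obtains v x where "e = {split_vertex r G v x, split_vertex r G x v}" "{v, x} \<in> edges G"
  using assms by (auto simp: split_graph_def)

lemma split_graph_edge:
  "{v, x} \<in> edges G \<Longrightarrow> {split_vertex r G v x, split_vertex r G x v} \<in> edges (split_graph r G)"
  by (auto simp: split_graph_def)

text \<open>Projecting an edge to \<open>G\<close> loses nothing, because each end is the copy that
  faces the projection of the other end.\<close>

lemma split_graph_edgeD:
  assumes "{p, q} \<in> edges (split_graph r G)"
  shows "{fst p, fst q} \<in> edges G"
    "p = split_vertex r G (fst p) (fst q)" "q = split_vertex r G (fst q) (fst p)"
proof -
  obtain v x where pq: "{p, q} = {split_vertex r G v x, split_vertex r G x v}"
    and vx: "{v, x} \<in> edges G"
    using assms by (rule split_graph_edgesE)
  then consider "p = split_vertex r G v x" "q = split_vertex r G x v"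
    | "p = split_vertex r G x v" "q = split_vertex r G v x"
    by (auto simp: doubleton_eq_iff)
  then have "{fst p, fst q} \<in> edges G \<and> p = split_vertex r G (fst p) (fst q) \<and>
    q = split_vertex r G (fst q) (fst p)"
    using vx by cases (simp_all add: insert_commute)
  then show "{fst p, fst q} \<in> edges G"
    "p = split_vertex r G (fst p) (fst q)" "q = split_vertex r G (fst q) (fst p)"
    by auto
qed

lemma wf_split_graph:
  assumes "wf_graph G"
  shows "wf_graph (split_graph r G)"
  unfolding wf_graph_def
proof
  fix e assume "e \<in> edges (split_graph r G)"
  then obtain v x where e: "e = {split_vertex r G v x, split_vertex r G x v}" "{v, x} \<in> edges G"
    by (rule split_graph_edgesE)
  moreover have "{x, v} \<in> edges G" using e(2) by (simp add: insert_commute)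
  moreover have "v \<noteq> x" using wf_graph_edgeD[OF assms e(2)] by simp
  then have "split_vertex r G v x \<noteq> split_vertex r G x v" by (simp add: split_vertex_eq_iff)
  ultimately show "e \<subseteq> verts (split_graph r G) \<and> card e = 2"
    by (auto intro: split_vertex_in_split_graph)
qed

lemma split_graph_adj:
  "{v, x} \<in> edges G \<Longrightarrow> (split_vertex r G v x, split_vertex r G x v) \<in> adj (split_graph r G)"
  by (auto simp: adj_def insert_commute intro: split_vertex_in_split_graph split_graph_edge)

text \<open>At each vertex of a short cycle, predecessor and successor are in one class, so the
  lifted cycle enters and leaves through the same copy.\<close>

lemma lift_short_cycle:
  assumes cyc: "is_cycle G (v # p)" and len: "enat (Suc (length p)) \<le> r"
  obtains p' where "is_cycle (split_graph r G) (split_vertex r G v (hd p) # p')"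
    "map fst p' = p" "hd p' = split_vertex r G (hd p) v" "last p' = split_vertex r G (last p) v"
proof -
  let ?S = "split_graph r G"
  define c where "c = v # p"
  define n where "n = length c"
  \<comment> \<open>The copy is chosen by the successor; \<open>l_eq\<close> shows that the
    predecessor selects the same one.\<close>
  define l where "l = (\<lambda>i. split_vertex r G (c ! i) (c ! (Suc i mod n)))"
  define c' where "c' = map l [0..<n]"
  have n: "3 \<le> n" and dist: "distinct c"
    and e: "\<And>i. i < n \<Longrightarrow> {c ! i, c ! (Suc i mod n)} \<in> edges G"
    using cyc by (auto simp: is_cycle_def c_def n_def)
  have l_eq: "l (Suc i mod n) = split_vertex r G (c ! (Suc i mod n)) (c ! i)" if i: "i < n" for i
  proof -
    let ?j = "Suc i mod n"
    have j: "?j < n" using n by simp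
    have "(?j + n - 1) mod n = i" using i by (cases "Suc i = n") auto
    then have "(c ! i, c ! (Suc ?j mod n)) \<in> short_cycle_rel r G (c ! ?j)"
      using short_cycle_rel_nth[of G c r ?j] cyc len j unfolding c_def[symmetric] n_def
      by (simp add: c_def)
    then have "nbr_class r G (c ! ?j) (c ! (Suc ?j mod n)) = nbr_class r G (c ! ?j) (c ! i)"
      by (intro nbr_class_eq) (auto simp: nbr_class_def)
    then show ?thesis by (simp add: l_def split_vertex_eq_iff)
  qed
  have fst_c': "map fst c' = c" by (simp add: c'_def l_def n_def o_def map_nth)
  have cyc': "is_cycle ?S c'"
    unfolding is_cycle_def
  proof (intro conjI allI impI)
    show "3 \<le> length c'" using n by (simp add: c'_def)
    \<comment> \<open>The lift projects onto the distinct list \<open>c\<close>, so it cannot repeat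
      a vertex.\<close>
    show "distinct c'" using dist fst_c' by (metis distinct_map)
    show "set c' \<subseteq> verts ?S"
      using split_vertex_in_split_graph[OF e, of _ r] unfolding c'_def l_def by force
    fix i assume "i < length c'"
    then have i: "i < n" by (simp add: c'_def)
    then show "{c' ! i, c' ! (Suc i mod length c')} \<in> edges ?S"
      using split_graph_edge[OF e[OF i]] l_eq[OF i] n by (simp add: c'_def) (simp add: l_def)
  qed
  obtain q p' where c': "c' = q # p'" using n by (cases c') (auto simp: c'_def)
  have p': "map fst p' = p" "fst q = v" using fst_c' c' by (auto simp: c_def)
  note cc = is_cycle_ConsD[OF cyc'[unfolded c']]
  have h: "fst (hd p') = hd p" "fst (last p') = last p"
    using p' cc(1) by (auto simp: hd_map last_map)
  have "q = split_vertex r G v (hd p)" "hd p' = split_vertex r G (hd p) v"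
    "last p' = split_vertex r G (last p) v"
    using split_graph_edgeD[OF cc(6)] split_graph_edgeD[OF cc(7)] h p' by simp_all
  with cyc' c' p' show ?thesis by (intro that[of p']) auto
qed

section \<open>Components of the split graph\<close>

lemma is_cycle_component:
  assumes cyc: "is_cycle G (v # p)" and v: "v \<in> component G x"
  shows "is_cycle (induced G (component G x)) (v # p)"
proof -
  let ?c = "v # p" and ?C = "component G x"
  let ?n = "length ?c"
  have V: "set ?c \<subseteq> verts G" and e: "\<And>i. i < ?n \<Longrightarrow> {?c ! i, ?c ! (Suc i mod ?n)} \<in> edges G"
    using cyc unfolding is_cycle_def by blast+
  have in_C: "?c ! i \<in> ?C" if "i < ?n" for i
    using that
  proof (induction i)
    case 0
    then show ?case using v by simp
  next
    case (Suc i)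
    have "?c ! i \<in> verts G" "?c ! Suc i \<in> verts G"
      using V Suc.prems by (meson Suc_lessD nth_mem subsetD)+
    then have "(?c ! i, ?c ! Suc i) \<in> adj G" using e[of i] Suc.prems by (simp add: adj_def)
    with Suc show ?case by (auto simp: component_def intro: rtrancl_into_rtrancl)
  qed
  have "{?c ! i, ?c ! (Suc i mod ?n)} \<in> edges (induced G ?C)" if "i < ?n" for i
    using e[OF that] in_C[OF that] in_C[of "Suc i mod ?n"] by (simp add: induced_def)
  moreover have "set ?c \<subseteq> ?C" using in_C unfolding subset_iff in_set_conv_nth by blast
  then have "set ?c \<subseteq> verts (induced G ?C)" using V by (auto simp: induced_def)
  ultimately show ?thesis using cyc unfolding is_cycle_def by blast
qed

text \<open>Two neighbours of \<open>q\<close> project to members of the one class that names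
  \<open>q\<close>. The chain of short cycles between them in \<open>G\<close> lifts, link by link,
  to short cycles through \<open>q\<close>.\<close>

lemma split_component_no_local_cutvertex:
  assumes wf: "wf_graph G"
  shows "\<not> local_cutvertex r (induced (split_graph r G) (component (split_graph r G) f)) q"
proof (rule not_local_cutvertexI)
  let ?S = "split_graph r G"
  let ?H = "induced ?S (component ?S f)"
  show "wf_graph ?H" by (intro wf_graph_induced wf_split_graph wf)
  fix a b assume ab: "{q, a} \<in> edges ?H" "{q, b} \<in> edges ?H"
  define v x y where "v = fst q" and "x = fst a" and "y = fst b"
  have "{q, a} \<in> edges ?S" "{q, b} \<in> edges ?S" and qC: "q \<in> component ?S f"
    using ab by (auto simp: induced_def)
  from split_graph_edgeD[OF this(1)] split_graph_edgeD[OF this(2)]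
  have a: "a = split_vertex r G x v" and b: "b = split_vertex r G y v"
    and q: "q = split_vertex r G v x" "q = split_vertex r G v y"
    unfolding v_def x_def y_def by simp_all
  have "nbr_class r G v x = nbr_class r G v y" using q by (simp add: split_vertex_eq_iff)
  then have "y \<in> nbr_class r G v x" using self_in_nbr_class[of y r G v] by simp
  then have "(x, y) \<in> (short_cycle_rel r G v)\<^sup>*" by (simp add: nbr_class_def)
  then have "(split_vertex r G x v, split_vertex r G y v) \<in> (short_cycle_rel r ?H q)\<^sup>*"
  proof (induction)
    case (step y z)
    obtain p where p: "is_cycle G (v # p)" "enat (Suc (length p)) \<le> r"
      and yz: "y = hd p \<and> z = last p \<or> y = last p \<and> z = hd p"
      using step(2) by (auto simp: short_cycle_rel_def)
    obtain p' where p': "is_cycle ?S (split_vertex r G v (hd p) # p')" "map fst p' = p"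
      "hd p' = split_vertex r G (hd p) v" "last p' = split_vertex r G (last p) v"
      using lift_short_cycle[OF p] .
    \<comment> \<open>The chain never leaves the class of \<open>x\<close>, hence each lifted cycle
      passes through \<open>q\<close> itself and not through another copy of
      \<open>v\<close>.\<close>
    have "y \<in> nbr_class r G v x" "z \<in> nbr_class r G v x"
      using step(1,2) by (auto simp: nbr_class_def intro: rtrancl_into_rtrancl)
    then have "nbr_class r G v (hd p) = nbr_class r G v x"
      using yz nbr_class_eq by metis
    then have "split_vertex r G v (hd p) = q" using q by (simp add: split_vertex_eq_iff)
    then have "is_cycle ?H (q # p')" using is_cycle_component[OF p'(1)] qC by simp
    moreover have "enat (Suc (length p')) \<le> r" using p(2) p'(2) by (metis length_map)
    ultimately have "(split_vertex r G y v, split_vertex r G z v) \<in> short_cycle_rel r ?H q"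
      using yz p'(3,4) by (auto simp: short_cycle_rel_def intro!: exI[of _ p'])
    with step.IH show ?case by (rule rtrancl_into_rtrancl)
  qed simp
  then show "(a, b) \<in> (short_cycle_rel r ?H q)\<^sup>*" using a b by simp
qed

text \<open>Either some copy in the component has a short cycle in its class, and this cycle lifts
  into the component, or all classes there are singletons and every vertex has a single
  neighbour.\<close>

lemma split_component_cases:
  assumes wf: "wf_graph G" and f: "f \<in> verts (split_graph r G)"
  defines "H \<equiv> induced (split_graph r G) (component (split_graph r G) f)"
  shows "locally_2_connected r H \<or> single_edge H"
proof -
  let ?S = "split_graph r G"
  let ?C = "component ?S f"
  show ?thesis
  proof (cases "\<exists>v x z. split_vertex r G v x \<in> ?C \<and> (x, z) \<in> short_cycle_rel r G v")
    case True
    then obtain v x z where vx: "split_vertex r G v x \<in> ?C" and xz: "(x, z) \<in> short_cycle_rel r G v"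
      by blast
    obtain p where p: "is_cycle G (v # p)" "enat (Suc (length p)) \<le> r"
      and yz: "x = hd p \<and> z = last p \<or> x = last p \<and> z = hd p"
      using xz by (auto simp: short_cycle_rel_def)
    obtain p' where p': "is_cycle ?S (split_vertex r G v (hd p) # p')" "map fst p' = p"
      using lift_short_cycle[OF p] by metis
    have "z \<in> nbr_class r G v x" using xz by (auto simp: nbr_class_def)
    then have "nbr_class r G v (hd p) = nbr_class r G v x"
      using yz nbr_class_eq by metis
    then have "split_vertex r G v (hd p) \<in> ?C" using vx by (simp add: split_vertex_def)
    from is_cycle_component[OF p'(1) this]
    have "is_cycle H (split_vertex r G v (hd p) # p')" by (simp add: H_def)
    moreover have "enat (length (split_vertex r G v (hd p) # p')) \<le> r"
      using p(2) p'(2) by (metis length_map length_Cons)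
    ultimately have "locally_2_connected r H"
      using connected_component[OF f] split_component_no_local_cutvertex[OF wf]
      unfolding locally_2_connected_def H_def by blast
    then show ?thesis ..
  next
    case False
    have single: "nbr_class r G v x = {x}" if "split_vertex r G v x \<in> ?C" for v x
      using that False by (auto simp: nbr_class_def elim: converse_rtranclE)
    obtain v x where fv: "f = split_vertex r G v x" and vx: "{v, x} \<in> edges G"
      using f by (rule split_graph_vertsE)
    define g where "g = split_vertex r G x v"
    have fC: "f \<in> ?C" by (rule self_in_component)
    have gC: "g \<in> ?C"
      using split_graph_adj[OF vx, of r] fv by (auto simp: component_def g_def)
    \<comment> \<open>A neighbour of a copy projects into the class of this copy; a singleton class
      therefore leaves only one neighbour.\<close>
    have nbr_unique: "z = split_vertex r G b a"
      if "(split_vertex r G a b, z) \<in> adj ?S" "nbr_class r G a b = {b}" for a b z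
    proof -
      have "{split_vertex r G a b, z} \<in> edges ?S" using that(1) by (simp add: adj_def)
      note e = split_graph_edgeD[OF this]
      have "nbr_class r G a b = nbr_class r G a (fst z)" using e(2) by (simp add: split_vertex_eq_iff)
      then have "fst z = b" using that(2) self_in_nbr_class[of "fst z" r G a] by (metis singletonD)
      then show ?thesis using e(3) by simp
    qed
    \<comment> \<open>From \<open>f\<close> one can only move to \<open>g\<close>, and from
      \<open>g\<close> only back to \<open>f\<close>.\<close>
    have C: "?C = {f, g}"
    proof
      show "?C \<subseteq> {f, g}"
      proof
        fix y assume "y \<in> ?C"
        then have "(f, y) \<in> (adj ?S)\<^sup>*" by (simp add: component_def)
        then show "y \<in> {f, g}"
        proof (induction)
          case (step y z)
          then show ?case
            using nbr_unique[of v x z] nbr_unique[of x v z]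
              single[of v x] single[of x v] fC gC fv g_def
            by auto
        qed simp
      qed
    qed (use fC gC in simp)
    have fg: "f \<noteq> g" using wf_graph_edgeD(3)[OF wf vx] by (auto simp: fv g_def split_vertex_eq_iff)
    have "{f, g} \<in> edges ?S" using split_graph_edge[OF vx] by (simp add: fv g_def)
    moreover have "e = {f, g}" if "e \<in> edges ?S" "e \<subseteq> {f, g}" for e
      using that wf_split_graph[OF wf, of r] fg
      by (intro card_subset_eq) (auto simp: wf_graph_def)
    ultimately have "edges H = {{f, g}}" using C by (auto simp: H_def induced_def)
    moreover have "verts H = {f, g}"
      using C component_subset_verts[OF f] by (auto simp: H_def induced_def)
    ultimately show ?thesis using fg unfolding single_edge_def by blast
  qed
qed


section \<open>The decomposition\<close>

text \<open>In a connected graph with at least two vertices, the first step of a path from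
  \<open>v\<close> to another vertex provides a neighbour, and thereby a copy of
  \<open>v\<close>.\<close>

lemma split_graph_verts_fst:
  assumes "connected_graph G" "\<nexists>v. verts G = {v}" "wf_graph G"
  shows "fst ` verts (split_graph r G) = verts G"
proof
  show "fst ` verts (split_graph r G) \<subseteq> verts G"
    using wf_graph_edgeD[OF assms(3)] by (auto elim!: split_graph_vertsE)
  show "verts G \<subseteq> fst ` verts (split_graph r G)"
  proof
    fix v assume v: "v \<in> verts G"
    then obtain u where "u \<in> verts G" "u \<noteq> v" using assms(2) by blast
    moreover from this have "(v, u) \<in> (adj G)\<^sup>*"
      using assms(1) v unfolding connected_graph_def disconnected_graph_iff by blast
    ultimately obtain x where "(v, x) \<in> adj G" by (auto elim: converse_rtranclE)
    then have "split_vertex r G v x \<in> verts (split_graph r G)"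
      by (auto simp: adj_def intro: split_vertex_in_split_graph)
    then show "v \<in> fst ` verts (split_graph r G)" by (metis fst_split_vertex image_eqI)
  qed
qed

text \<open>Bags are named by the vertex sets of components, separators by vertices of
  \<open>G\<close>, and links by the copies. Two copies of a vertex in one component yield parallel
  links. The map \<open>emb\<close> may be constant because a separator has only one vertex.\<close>

definition local_dec ::
  "enat \<Rightarrow> 'a ugraph \<Rightarrow> (('a \<times> 'a set) set, 'a, 'a \<times> 'a set, 'a \<times> 'a set, 'a) graph_dec" where
  "local_dec r G =
     \<lparr>bags = component (split_graph r G) ` verts (split_graph r G),
      seps = verts G,
      links = verts (split_graph r G),
      sep_of = fst,
      bag_of = component (split_graph r G),
      bag_graph = induced (split_graph r G),
      sep_graph = (\<lambda>v. \<lparr>verts = {v}, edges = {}\<rparr>),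
      emb = (\<lambda>f _. f)\<rparr>"

lemma local_dec_simps [simp]:
  "bags (local_dec r G) = component (split_graph r G) ` verts (split_graph r G)"
  "seps (local_dec r G) = verts G"
  "links (local_dec r G) = verts (split_graph r G)"
  "sep_of (local_dec r G) = fst"
  "bag_of (local_dec r G) = component (split_graph r G)"
  "bag_graph (local_dec r G) = induced (split_graph r G)"
  "sep_graph (local_dec r G) = (\<lambda>v. \<lparr>verts = {v}, edges = {}\<rparr>)"
  "emb (local_dec r G) = (\<lambda>f _. f)"
  by (simp_all add: local_dec_def)

text \<open>The choice does not affect the result on the vertex classes of \<open>local_dec\<close>,
  whose members are all copies of one vertex.\<close>

definition class_vertex :: "('b \<times> 'a \<times> 'c) set \<Rightarrow> 'a" where
  "class_vertex X = fst (snd (SOME p. p \<in> X))"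

section \<open>The underlying graph of the decomposition\<close>

context
  fixes G :: "'a ugraph" and r :: enat
  assumes wf: "wf_graph G"
    and conn: "connected_graph G"
    and not_single: "\<nexists>v. verts G = {v}"
begin

private abbreviation "S \<equiv> split_graph r G"
private abbreviation "D \<equiv> local_dec r G"

text \<open>Each copy lies in exactly one component, so the disjoint union of the bags is the split
  graph with a redundant label.\<close>

lemma sum_verts_local_dec: "sum_verts D = (\<lambda>f. (component S f, f)) ` verts S"
proof -
  have "component S f = component S g" if "g \<in> component S f" for f g
    using component_eq[OF that] by simp
  then show ?thesis
    by (auto simp: sum_verts_def induced_def self_in_component image_iff)
qed

lemma sum_edges_local_dec:
  "(b, e) \<in> sum_edges D \<longleftrightarrow> e \<in> edges S \<and> (\<forall>x\<in>e. b = component S x)"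
proof
  assume "(b, e) \<in> sum_edges D"
  then obtain f where "b = component S f" "e \<in> edges S" "e \<subseteq> b"
    by (auto simp: sum_edges_def induced_def)
  then show "e \<in> edges S \<and> (\<forall>x\<in>e. b = component S x)" using component_eq by (metis subsetD)
next
  assume *: "e \<in> edges S \<and> (\<forall>x\<in>e. b = component S x)"
  then obtain x where x: "x \<in> e" by (metis split_graph_edgesE insertI1)
  have "e \<subseteq> b" using * self_in_component by (metis subsetI)
  moreover have "x \<in> verts S" using wf_split_graph[OF wf, of r] * x by (auto simp: wf_graph_def)
  ultimately show "(b, e) \<in> sum_edges D" using * x by (auto simp: sum_edges_def induced_def)
qed

text \<open>Gluing relates any two copies of the same vertex directly; being already transitive, it
  needs only reflexivity to become its closure.\<close>

lemma v_class_local_dec: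
  assumes "f \<in> verts S"
  shows "v_class D (component S f, f) = {(component S g, g) | g. g \<in> verts S \<and> fst g = fst f}"
proof -
  have glue: "v_glue D = {((component S f, f), (component S g, g)) | f g.
    f \<in> verts S \<and> g \<in> verts S \<and> fst f = fst g}"
    by (auto simp: v_glue_def)
  have "trans (v_glue D)" unfolding glue by (rule transI) auto
  then have "(v_glue D)\<^sup>* = (v_glue D)\<^sup>=" by (metis rtrancl_trancl_reflcl trancl_id)
  then have "v_class D p = insert p (v_glue D `` {p})" for p by (auto simp: v_class_def)
  moreover have "v_glue D `` {(component S f, f)} =
    {(component S g, g) | g. g \<in> verts S \<and> fst g = fst f}"
    unfolding glue using assms by (auto simp del: split_paired_Ex)
  ultimately show ?thesis using assms by (auto simp del: split_paired_Ex)
qed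

lemma proj_local_dec:
  assumes "f \<in> verts S"
  shows "proj D class_vertex (component S f, f) = fst f"
proof -
  let ?X = "v_class D (component S f, f)"
  have "(component S f, f) \<in> ?X" using assms by (simp add: v_class_def)
  then have "(SOME p. p \<in> ?X) \<in> ?X" by (rule someI)
  then show ?thesis unfolding proj_def class_vertex_def using v_class_local_dec[OF assms] by auto
qed

lemma proj_local_dec_edge:
  assumes "e \<in> edges S" "\<forall>x\<in>e. b = component S x"
  shows "(\<lambda>x. proj D class_vertex (b, x)) ` e = fst ` e"
proof (rule image_cong[OF refl])
  fix x assume "x \<in> e"
  moreover from this have "x \<in> verts S"
    using wf_split_graph[OF wf, of r] assms(1) by (auto simp: wf_graph_def)
  ultimately show "proj D class_vertex (b, x) = fst x" using assms(2) proj_local_dec by simp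
qed

text \<open>An edge of \<open>G\<close> determines both copies at its ends, so identifying copies
  creates no parallel edges.\<close>

lemma split_graph_edge_fst_inj:
  assumes "e \<in> edges S" "e' \<in> edges S" "fst ` e = fst ` e'"
  shows "e = e'"
proof -
  obtain v x where e: "e = {split_vertex r G v x, split_vertex r G x v}"
    using assms(1) by (rule split_graph_edgesE)
  obtain w y where e': "e' = {split_vertex r G w y, split_vertex r G y w}"
    using assms(2) by (rule split_graph_edgesE)
  have "{v, x} = {w, y}" using assms(3) e e' by simp
  then show ?thesis using e e' by (auto simp: doubleton_eq_iff)
qed

lemma graph_decomposition_of_local_dec: "graph_decomposition_of D class_vertex G"
proof -
  have "wf_dec D"
    using split_graph_verts_fst[OF conn not_single wf, of r] wf_split_graph[OF wf, of r]
    by (auto simp: wf_dec_def embedding_def wf_graph_induced induced_def self_in_component wf_graph_def)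
  moreover have "bij_betw class_vertex (u_verts D) (verts G)"
  proof -
    have U: "u_verts D = (\<lambda>f. v_class D (component S f, f)) ` verts S"
      by (auto simp: u_verts_def quotient_def sum_verts_local_dec v_class_def)
    have c: "class_vertex (v_class D (component S f, f)) = fst f" if "f \<in> verts S" for f
      using proj_local_dec[OF that] by (simp add: proj_def)
    have "inj_on class_vertex (u_verts D)"
      unfolding U
    proof (rule inj_onI, elim imageE)
      fix X Y f g
      assume eq: "class_vertex X = class_vertex Y" and fg: "f \<in> verts S" "g \<in> verts S"
        and X: "X = v_class D (component S f, f)" and Y: "Y = v_class D (component S g, g)"
      have "fst f = fst g" using eq c[OF fg(1)] c[OF fg(2)] unfolding X Y by metis
      then show "X = Y" unfolding X Y v_class_local_dec[OF fg(1)] v_class_local_dec[OF fg(2)] by simp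
    qed
    moreover have "class_vertex ` u_verts D = fst ` verts S"
      unfolding U image_image by (rule image_cong) (simp_all add: c)
    ultimately show ?thesis
      using split_graph_verts_fst[OF conn not_single wf] by (simp add: bij_betw_def)
  qed
  moreover have "bij_betw (\<lambda>X. class_vertex ` u_ends D X) (u_edges D) (edges G)"
  proof -
    \<comment> \<open>The separators have no edges, so every edge class is a singleton.\<close>
    have "e_glue D = {}" by (auto simp: e_glue_def)
    then have U: "u_edges D = (\<lambda>p. {p}) ` sum_edges D"
      by (auto simp: u_edges_def quotient_def)
    have ends: "class_vertex ` u_ends D {(b, e)} = fst ` e" if "(b, e) \<in> sum_edges D" for b e
    proof -
      have "class_vertex ` u_ends D {(b, e)} = (\<lambda>x. proj D class_vertex (b, x)) ` e"
        by (auto simp: u_ends_def proj_def)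
      also have "\<dots> = fst ` e"
        using that by (intro proj_local_dec_edge) (simp_all add: sum_edges_local_dec)
      finally show ?thesis .
    qed
    have "inj_on (\<lambda>X. class_vertex ` u_ends D X) (u_edges D)"
      unfolding U
    proof (rule inj_onI)
      fix X Y
      assume XY: "X \<in> (\<lambda>p. {p}) ` sum_edges D" "Y \<in> (\<lambda>p. {p}) ` sum_edges D"
        "class_vertex ` u_ends D X = class_vertex ` u_ends D Y"
      then obtain b e b' e' where X: "X = {(b, e)}" "(b, e) \<in> sum_edges D"
        and Y: "Y = {(b', e')}" "(b', e') \<in> sum_edges D"
        by (elim imageE) auto
      have "e \<in> edges S" "e' \<in> edges S" using X Y by (auto simp: sum_edges_local_dec)
      moreover have "fst ` e = fst ` e'" using XY X Y ends by simp
      ultimately have "e = e'" by (rule split_graph_edge_fst_inj)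
      \<comment> \<open>The component of any endvertex determines the bag containing the
        edge.\<close>
      moreover obtain x where "x \<in> e" using \<open>e \<in> edges S\<close> by (metis split_graph_edgesE insertI1)
      ultimately have "b = b'" using X Y by (auto simp: sum_edges_local_dec)
      with \<open>e = e'\<close> show "X = Y" using X Y by simp
    qed
    moreover have "(\<lambda>X. class_vertex ` u_ends D X) ` u_edges D = edges G"
    proof
      show "(\<lambda>X. class_vertex ` u_ends D X) ` u_edges D \<subseteq> edges G"
        unfolding U by (auto simp: ends) (auto simp: sum_edges_local_dec elim!: split_graph_edgesE)
      show "edges G \<subseteq> (\<lambda>X. class_vertex ` u_ends D X) ` u_edges D"
      proof
        fix e assume e: "e \<in> edges G"
        then have "card e = 2" using wf by (auto simp: wf_graph_def)
        then obtain v x where vx: "e = {v, x}" by (auto simp: card_2_iff)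
        let ?e = "{split_vertex r G v x, split_vertex r G x v}"
        let ?b = "component S (split_vertex r G v x)"
        have "split_vertex r G x v \<in> ?b"
          using split_graph_adj[of v x G r] e vx by (auto simp: component_def)
        then have "(?b, ?e) \<in> sum_edges D"
          using split_graph_edge[of v x G r] e vx
          by (auto simp: sum_edges_local_dec dest: component_eq)
        moreover have "class_vertex ` u_ends D {(?b, ?e)} = e" using ends[OF calculation] vx by simp
        ultimately show "e \<in> (\<lambda>X. class_vertex ` u_ends D X) ` u_edges D" unfolding U by blast
      qed
    qed
    ultimately show ?thesis by (simp add: bij_betw_def)
  qed
  ultimately show ?thesis by (simp add: graph_decomposition_of_def)
qed

section \<open>Labels, locality and adhesion\<close>

lemma link_image_local_dec: "link_image D f = {(component S f, f)}"
  by (simp add: link_image_def)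

lemma sep_verts_local_dec:
  assumes "s \<in> verts G"
  shows "sep_verts D class_vertex s = {s}"
proof -
  have "sep_verts D class_vertex s = fst ` {f \<in> verts S. fst f = s}"
    unfolding sep_verts_def links_at_def link_image_local_dec
    by (auto simp: proj_local_dec image_iff)
  moreover have "s \<in> fst ` verts S" using split_graph_verts_fst[OF conn not_single wf] assms by simp
  ultimately show ?thesis by auto
qed

text \<open>Only one edge of the split graph lies over \<open>{s, w}\<close>, and its only end over
  \<open>s\<close> is the copy facing \<open>w\<close>. Links being copies, this end is itself the
  label.\<close>

lemma has_label_local_dec:
  assumes "{s, w} \<in> edges G"
  shows "has_label D class_vertex s {s, w} f \<longleftrightarrow> f = split_vertex r G s w"
proof
  assume "has_label D class_vertex s {s, w} f"
  then obtain e where f: "fst f = s" "f \<in> e" and e: "e \<in> edges S" "e \<subseteq> component S f"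
    and im: "(\<lambda>y. proj D class_vertex (component S f, y)) ` e = {s, w}"
    by (auto simp: has_label_def links_at_def link_image_local_dec induced_def)
  have "\<forall>x\<in>e. component S f = component S x"
    using component_eq[of _ S f] e(2) by (metis subsetD)
  from proj_local_dec_edge[OF e(1) this] have "fst ` e = {s, w}" using im by simp
  also have "\<dots> = fst ` {split_vertex r G s w, split_vertex r G w s}" by simp
  finally have "e = {split_vertex r G s w, split_vertex r G w s}"
    by (rule split_graph_edge_fst_inj[OF e(1) split_graph_edge[OF assms]])
  then have "f = split_vertex r G s w \<or> f = split_vertex r G w s" using f(2) by simp
  then show "f = split_vertex r G s w"
    using f(1) wf_graph_edgeD(3)[OF wf assms] by (metis fst_split_vertex)
next
  assume f: "f = split_vertex r G s w"
  let ?e = "{split_vertex r G s w, split_vertex r G w s}"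
  have w: "split_vertex r G w s \<in> component S f"
    using split_graph_adj[OF assms] f by (auto simp: component_def)
  have e: "?e \<in> edges S" by (rule split_graph_edge[OF assms])
  have "\<forall>x\<in>?e. component S f = component S x"
    using f component_eq[OF w] by simp
  from proj_local_dec_edge[OF e this]
  have "(\<lambda>y. proj D class_vertex (component S f, y)) ` ?e = {s, w}" by simp
  moreover have "?e \<in> edges (induced S (component S f))"
    using e w f self_in_component[of f S] by (simp add: induced_def)
  moreover have "f \<in> verts S" "fst f = s"
    using split_vertex_in_split_graph[OF assms, of r] f by simp_all
  moreover have "f \<in> ?e" using f by simp
  ultimately show "has_label D class_vertex s {s, w} f"
    unfolding has_label_def links_at_def link_image_local_dec
    by (intro conjI bexI[of _ ?e] bexI[of _ f]) simp_all
qed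

lemma edge_label_local_dec:
  "{s, w} \<in> edges G \<Longrightarrow> edge_label D class_vertex s {s, w} = split_vertex r G s w"
  by (simp add: edge_label_def has_label_local_dec)

text \<open>More than parity is obtained: a cycle of length at most \<open>r\<close> has no
  traversal at all, because its two edges at a separator vertex carry the same label.\<close>

lemma has_locality_local_dec: "has_locality D class_vertex G r"
  unfolding has_locality_def
proof (intro conjI allI impI)
  show "labelling_well_defined D class_vertex G"
    by (auto simp: labelling_well_defined_def sep_verts_local_dec link_image_local_dec
        has_label_local_dec)
  fix c assume cyc: "is_cycle G c" and "\<exists>s\<in>seps D. odd (card (traversals D class_vertex s c))"
  then obtain s where s: "s \<in> verts G" and "odd (card (traversals D class_vertex s c))" by auto
  then have "traversals D class_vertex s c \<noteq> {}" by (metis card.empty even_zero)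
  then obtain i k where "(i, k) \<in> traversals D class_vertex s c" by auto
  moreover define n where "n = length c"
  ultimately have i: "i < n" and k: "1 \<le> k" "k < n" and in_s: "\<And>j. j < k \<Longrightarrow> c ! ((i + j) mod n) = s"
    and label: "edge_label D class_vertex s {c ! ((i + n - 1) mod n), c ! (i mod n)} \<noteq>
      edge_label D class_vertex s {c ! ((i + k - 1) mod n), c ! ((i + k) mod n)}"
    unfolding traversals_def Let_def by (auto simp: sep_verts_local_dec[OF s])
  have n: "3 \<le> n" and dist: "distinct c"
    and e: "\<And>i. i < n \<Longrightarrow> {c ! i, c ! (Suc i mod n)} \<in> edges G"
    using cyc by (auto simp: is_cycle_def n_def)
  have ci: "c ! i = s" using in_s[of 0] i k by simp
  \<comment> \<open>The separator is one vertex and the cycle visits it only once, so a traversal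
    cannot contain two positions.\<close>
  have "k = 1"
  proof (rule ccontr)
    assume "k \<noteq> 1"
    then have "c ! (Suc i mod n) = c ! i" using in_s[of 1] ci k by simp
    moreover have "Suc i mod n < n" using n by simp
    ultimately have "Suc i mod n = i" using nth_eq_iff_index_eq[OF dist] i by (simp add: n_def)
    then show False using i n by (cases "Suc i = n") auto
  qed
  let ?p = "c ! ((i + n - 1) mod n)" and ?q = "c ! (Suc i mod n)"
  have "Suc ((i + n - 1) mod n) mod n = i" using i n by (simp add: mod_Suc_eq)
  then have edges: "{s, ?p} \<in> edges G" "{s, ?q} \<in> edges G"
    using e[of "(i + n - 1) mod n"] e[OF i] ci n by (auto simp: insert_commute)
  have "split_vertex r G s ?p \<noteq> split_vertex r G s ?q"
    using label ci i \<open>k = 1\<close> edge_label_local_dec[OF edges(1)] edge_label_local_dec[OF edges(2)]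
    by (simp add: insert_commute)
  then have "?q \<notin> nbr_class r G s ?p"
    using nbr_class_eq by (fastforce simp: split_vertex_eq_iff)
  then have "(?p, ?q) \<notin> short_cycle_rel r G s" by (auto simp: nbr_class_def)
  then have "\<not> enat n \<le> r"
    using short_cycle_rel_nth[OF cyc, of r i] i ci by (auto simp: n_def)
  then show "r < enat (length c)" by (simp add: n_def)
qed

text \<open>Connectedness supplies a vertex, hence a separator at which the maximum is
  attained.\<close>

lemma has_adhesion_local_dec: "has_adhesion D 1"
  using conn by (auto simp: has_adhesion_def connected_graph_def)

end

text \<open>The one-vertex graph is excluded because it has no such decomposition: some bag would be
  required to supply its vertex, and every admissible bag contains an edge, which would then be an
  edge of \<open>G\<close>.\<close>

theorem theoremB1:
  fixes G :: "'a ugraph" and r :: enat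
  assumes "wf_graph G" and "connected_graph G" and "\<nexists>v. verts G = {v}"
  shows "\<exists>(D :: (('a \<times> 'a set) set, 'a, 'a \<times> 'a set, 'a \<times> 'a set, 'a) graph_dec) \<phi>.
           graph_decomposition_of D \<phi> G \<and> has_adhesion D 1 \<and> has_locality D \<phi> G r \<and>
           (\<forall>b\<in>bags D. locally_2_connected r (bag_graph D b) \<or> single_edge (bag_graph D b))"
proof (intro exI conjI)
  show "graph_decomposition_of (local_dec r G) class_vertex G"
    by (rule graph_decomposition_of_local_dec[OF assms])
  show "has_adhesion (local_dec r G) 1" by (rule has_adhesion_local_dec[OF assms])
  show "has_locality (local_dec r G) class_vertex G r" by (rule has_locality_local_dec[OF assms])
  show "\<forall>b\<in>bags (local_dec r G). locally_2_connected r (bag_graph (local_dec r G) b) \<or>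
      single_edge (bag_graph (local_dec r G) b)"
    using split_component_cases[OF assms(1)] by auto
qed

end
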